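(* Let $$E(x,y)=\sum_{n\geq 0}\sum_{\sigma\in S_n(123)}x^ny^{\mathrm{des}(\sigma)}.$$ Then $$E(x,y)=\frac{-1+2xy+2x^2y-2xy^2-4x^2y^2+2x^2y^3+\sqrt{1-4xy-4x^2y+4x^2y^2}}{2xy^2(xy-1-x)}.$$
   Context: $S_n(123)$ is the set of permutations $\sigma=\sigma(1)\cdots\sigma(n)$ of $\{1,\dots,n\}$ containing no indices $i<j<k$ with $\sigma(i)<\sigma(j)<\sigma(k)$ ($S_0(123)$ contains only the empty permutation). $\mathrm{des}(\sigma)$ is the number of indices $i$ with $\sigma(i)>\sigma(i+1)$. The square root is the formal power series branch with constant term $1$. *)

theory Defs
  imports
    "HOL-Combinatorics.Multiset_Permutations"
    "HOL-Computational_Algebra.Computational_Algebra"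
begin

text \<open>
  Permutations of \<open>{1..n}\<close> are in one-line notation; list positions start at 0, so the
  entry \<open>\<sigma>(i)\<close> of the usual notation is \<open>\<sigma> ! (i - 1)\<close>.
\<close>

definition contains_123 :: "nat list \<Rightarrow> bool" where
  "contains_123 \<sigma> \<longleftrightarrow>
     (\<exists>i j k. i < j \<and> j < k \<and> k < length \<sigma> \<and> \<sigma> ! i < \<sigma> ! j \<and> \<sigma> ! j < \<sigma> ! k)"

definition S123 :: "nat \<Rightarrow> nat list set" where
  "S123 n = {\<sigma> \<in> permutations_of_set {1..n}. \<not> contains_123 \<sigma>}"

definition des :: "nat list \<Rightarrow> nat" where
  "des \<sigma> = card {i. Suc i < length \<sigma> \<and> \<sigma> ! i > \<sigma> ! Suc i}"

text \<open>
  The ring of formal power series in \<open>x\<close> and \<open>y\<close> over the rationals is represented as the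
  power series in \<open>x\<close> whose coefficients are power series in \<open>y\<close>: the coefficient of
  \<open>x\<^sup>n y\<^sup>k\<close> in \<open>f\<close> is \<open>f $ n $ k\<close>. Library division on this type is unsuitable
  for denominators divisible by \<open>y\<close>, because \<open>y\<close> has no inverse among the coefficients;
  such quotients are to be formed in the fraction field \<open>fps2 fract\<close>.
\<close>

type_synonym fps2 = "rat fps fps"

definition X :: fps2 where
  "X = fps_X"

definition Y :: fps2 where
  "Y = fps_const fps_X"

definition E :: fps2 where
  "E = Abs_fps (\<lambda>n. \<Sum>\<sigma>\<in>S123 n. fps_X ^ des \<sigma>)"

lemma E_nth_nth: "E $ n $ k = of_nat (card {\<sigma> \<in> S123 n. des \<sigma> = k})"
proof -
  have "finite (S123 n)"
    by (simp add: S123_def)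
  moreover have "E $ n $ k = (\<Sum>\<sigma>\<in>S123 n. if des \<sigma> = k then 1 else 0)"
    by (simp add: E_def fps_sum_nth fps_X_power_nth eq_commute cong: if_cong)
  ultimately show ?thesis
    by (simp add: sum.If_cases Int_def)
qed

text \<open>
  The library's \<open>fps_radical\<close> needs coefficients in a field, so it does not apply to
  \<open>fps2\<close>. The description below is meaningful whenever such a root exists, since the
  root is then unique.
\<close>

definition sqrt2 :: "fps2 \<Rightarrow> fps2" where
  "sqrt2 f = (THE g. g ^ 2 = f \<and> g $ 0 $ 0 = 1)"

lemma sqrt2_eqI:
  assumes "g ^ 2 = f" and "g $ 0 $ 0 = 1"
  shows "sqrt2 f = g"
  unfolding sqrt2_def
proof (rule the_equality)
  fix h assume h: "h ^ 2 = f \<and> h $ 0 $ 0 = 1"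
  then have "h ^ 2 = g ^ 2"
    using assms(1) by simp
  then have "h = g \<or> h = - g"
    by (simp only: power2_eq_iff)
  then show "h = g"
    using h assms(2) by auto
qed (use assms in simp)

end

theory Submission
  imports Defs
begin

text \<open>
  Read a 123-avoiding permutation from left to right. If \<open>m\<close> is the current minimum and \<open>R\<close> the
  set of remaining values, the next entry is either some \<open>r \<in> R\<close> below \<open>m\<close>, which becomes the new
  minimum, or an \<open>r > m\<close>, which then has to be the largest element of \<open>R\<close> and imposes no further
  restriction. So the descent polynomial of the completions depends only on the number \<open>a\<close> of
  elements of \<open>R\<close> below \<open>m\<close>, the number \<open>b\<close> of those above \<open>m\<close>, and on whether the last entry
  read is \<open>m\<close> itself (series \<open>g b\<close>, with \<open>a\<close> as the exponent of \<open>x\<close>) or exceeds all of \<open>R\<close>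
  (series \<open>h b\<close>). With \<open>s b\<close> for the completions that begin with an element below \<open>m\<close>, this is a
  linear system with a unique solution. The solution is geometric, \<open>h b = p * k ^ b\<close>, where
  \<open>k = c + x * k\<^sup>2\<close> with \<open>c = y + x * y - x * y\<^sup>2\<close> and \<open>p = 1 / (1 - x * k)\<close>. The square root
  of the theorem is \<open>1 - 2 * x * k\<close>, and \<open>E = 1 + s 0\<close>.
\<close>

section \<open>Patterns 123 and descents of a list with a new first entry\<close>

fun ascent_above :: "nat \<Rightarrow> nat list \<Rightarrow> bool" where
  "ascent_above x [] \<longleftrightarrow> False"
| "ascent_above x (y # ys) \<longleftrightarrow> x < y \<and> (\<exists>z\<in>set ys. y < z) \<or> ascent_above x ys"

lemma ascent_above_iff:
  "ascent_above x ys \<longleftrightarrow> (\<exists>j k. j < k \<and> k < length ys \<and> x < ys ! j \<and> ys ! j < ys ! k)"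
proof (induction ys)
  case (Cons y ys)
  have "(\<exists>j k. j < k \<and> k < length (y # ys) \<and> x < (y # ys) ! j \<and> (y # ys) ! j < (y # ys) ! k)
    \<longleftrightarrow> (\<exists>k. k < length ys \<and> x < y \<and> y < ys ! k)
      \<or> (\<exists>j k. j < k \<and> k < length ys \<and> x < ys ! j \<and> ys ! j < ys ! k)" (is "?L \<longleftrightarrow> ?R")
  proof
    assume ?L
    then obtain j k where jk: "j < k" "k < length (y # ys)" "x < (y # ys) ! j"
      "(y # ys) ! j < (y # ys) ! k"
      by blast
    from jk(1) obtain k' where k: "k = Suc k'"
      by (cases k) auto
    show ?R
    proof (cases j)
      case 0
      then show ?thesis using jk k by auto
    next
      case (Suc j')
      then have "j' < k'" "k' < length ys" "x < ys ! j'" "ys ! j' < ys ! k'"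
        using jk k by auto
      then show ?thesis by blast
    qed
  next
    assume ?R
    then show ?L
    proof (elim disjE exE conjE)
      fix k assume "k < length ys" "x < y" "y < ys ! k"
      then show ?L by (intro exI[of _ 0] exI[of _ "Suc k"]) auto
    next
      fix j k assume "j < k" "k < length ys" "x < ys ! j" "ys ! j < ys ! k"
      then show ?L by (intro exI[of _ "Suc j"] exI[of _ "Suc k"]) auto
    qed
  qed
  moreover have "(\<exists>z\<in>set ys. y < z) \<longleftrightarrow> (\<exists>k. k < length ys \<and> y < ys ! k)"
    by (metis in_set_conv_nth)
  ultimately show ?case
    using Cons.IH by auto
qed simp

lemma contains_123_Nil [simp]: "\<not> contains_123 []"
  by (simp add: contains_123_def)

lemma contains_123_Cons:
  "contains_123 (x # xs) \<longleftrightarrow> contains_123 xs \<or> ascent_above x xs" (is "?L \<longleftrightarrow> ?R")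
proof
  assume ?L
  then obtain i j k where ijk: "i < j" "j < k" "k < length (x # xs)"
    "(x # xs) ! i < (x # xs) ! j" "(x # xs) ! j < (x # xs) ! k"
    unfolding contains_123_def by blast
  from ijk obtain j' k' where jk: "j = Suc j'" "k = Suc k'"
    by (cases j; cases k) auto
  show ?R
  proof (cases i)
    case 0
    then have "ascent_above x xs"
      unfolding ascent_above_iff using ijk jk by auto
    then show ?thesis ..
  next
    case (Suc i')
    then have "contains_123 xs"
      unfolding contains_123_def using ijk jk
      by (intro exI[of _ i'] exI[of _ j'] exI[of _ k']) auto
    then show ?thesis ..
  qed
next
  assume ?R
  then show ?L
  proof
    assume "contains_123 xs"
    then obtain i j k where "i < j" "j < k" "k < length xs" "xs ! i < xs ! j" "xs ! j < xs ! k"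
      unfolding contains_123_def by blast
    then show ?L
      unfolding contains_123_def
      by (intro exI[of _ "Suc i"] exI[of _ "Suc j"] exI[of _ "Suc k"]) auto
  next
    assume "ascent_above x xs"
    then obtain j k where "j < k" "k < length xs" "x < xs ! j" "xs ! j < xs ! k"
      unfolding ascent_above_iff by blast
    then show ?L
      unfolding contains_123_def
      by (intro exI[of _ 0] exI[of _ "Suc j"] exI[of _ "Suc k"]) auto
  qed
qed

lemma ascent_above_antimono: "ascent_above y xs \<Longrightarrow> x \<le> y \<Longrightarrow> ascent_above x xs"
  by (induction xs) auto

lemma ascent_above_max: "\<forall>y\<in>set xs. y \<le> x \<Longrightarrow> \<not> ascent_above x xs"
  by (induction xs) auto

text \<open>A pattern starting at \<open>m\<close> cannot use \<open>r\<close>, so it may start at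
  \<open>r\<close> instead.\<close>

lemma contains_123_smaller:
  assumes "r \<le> m"
  shows "contains_123 (m # r # l) \<longleftrightarrow> contains_123 (r # l)"
  using assms by (auto simp: contains_123_Cons dest: ascent_above_antimono)

text \<open>If some \<open>z > r\<close> follows, then \<open>m\<close>, \<open>r\<close>,
  \<open>z\<close> is a pattern. Otherwise nothing after \<open>r\<close> exceeds it and only
  \<open>m\<close> precedes it, so \<open>r\<close> occurs in no pattern and can be deleted.\<close>

lemma contains_123_larger:
  assumes "m < r"
  shows "contains_123 (m # r # l) \<longleftrightarrow> (\<exists>z\<in>set l. r < z) \<or> contains_123 (m # l)"
proof (cases "\<exists>z\<in>set l. r < z")
  case True
  then show ?thesis using assms by (auto simp: contains_123_Cons)
next
  case False
  then have "\<not> ascent_above r l"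
    by (intro ascent_above_max) auto
  then show ?thesis using assms False by (auto simp: contains_123_Cons)
qed

lemma des_single [simp]: "des [x] = 0"
  by (simp add: des_def)

lemma des_Nil [simp]: "des [] = 0"
  by (simp add: des_def)

lemma des_Cons_Cons [simp]: "des (x # y # l) = (if y < x then 1 else 0) + des (y # l)"
proof -
  have "{i. Suc i < length (x # y # l) \<and> (x # y # l) ! i > (x # y # l) ! Suc i} =
      (if y < x then {0} else {}) \<union>
      Suc ` {i. Suc i < length (y # l) \<and> (y # l) ! i > (y # l) ! Suc i}" (is "?A = ?B \<union> Suc ` ?C")
  proof (rule set_eqI)
    fix i show "i \<in> ?A \<longleftrightarrow> i \<in> ?B \<union> Suc ` ?C"
      by (cases i) auto
  qed
  moreover have "finite ?C"
    by (rule finite_subset[of _ "{..<length (y # l)}"]) auto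
  ultimately show ?thesis
    unfolding des_def by (auto simp: card_insert_if card_image)
qed

section \<open>Splitting the completions by their first entry\<close>

definition avoiders :: "nat set \<Rightarrow> nat \<Rightarrow> nat list set" where
  "avoiders R m = {l \<in> permutations_of_set R. \<not> contains_123 (m # l)}"

lemma finite_avoiders [simp]: "finite R \<Longrightarrow> finite (avoiders R m)"
  by (simp add: avoiders_def)

lemma avoiders_empty: "avoiders {} m = {[]}"
  by (auto simp: avoiders_def contains_123_Cons)

text \<open>An entry below \<open>m\<close> takes over as minimum; an entry above \<open>m\<close>
  must have nothing larger after it, and leaves \<open>m\<close> in force.\<close>

lemma Cons_in_avoiders_iff:
  assumes "finite R" "m \<notin> R"
  shows "r # l \<in> avoiders R m \<longleftrightarrow>
    r \<in> R \<and> (r < m \<and> l \<in> avoiders (R - {r}) r \<or>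
      m < r \<and> r = Max R \<and> l \<in> avoiders (R - {r}) m)"
proof (cases "r \<in> R \<and> l \<in> permutations_of_set (R - {r})")
  case True
  then have r: "r \<in> R" and l: "l \<in> permutations_of_set (R - {r})" and "set l = R - {r}"
    by (auto simp: permutations_of_set_def)
  then have "r # l \<in> permutations_of_set R"
    by (auto simp: permutations_of_set_def)
  moreover have "(\<exists>z\<in>set l. r < z) \<longleftrightarrow> r \<noteq> Max R"
  proof -
    have "Max R \<in> R" using r assms by (intro Max_in) auto
    moreover have "\<forall>z\<in>R. z \<le> Max R" using assms by auto
    ultimately show ?thesis
      using \<open>set l = R - {r}\<close> r by (metis DiffD1 DiffI antisym_conv3 leD singletonD)
  qed
  moreover have "r \<noteq> m" using r assms by auto
  ultimately show ?thesis
    using r l contains_123_smaller[of r m l] contains_123_larger[of m r l]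
    by (cases "r < m") (auto simp: avoiders_def)
next
  case False
  then show ?thesis
    by (auto simp: avoiders_def permutations_of_set_def)
qed

lemma sum_avoiders:
  fixes w :: "nat list \<Rightarrow> 'a :: comm_monoid_add"
  assumes "finite R" "m \<notin> R" "R \<noteq> {}"
  shows "(\<Sum>l\<in>avoiders R m. w l) =
    (\<Sum>r\<in>{r \<in> R. r < m}. \<Sum>l\<in>avoiders (R - {r}) r. w (r # l)) +
    (if m < Max R then \<Sum>l\<in>avoiders (R - {Max R}) m. w (Max R # l) else 0)"
proof -
  let ?L = "\<lambda>r. (#) r ` avoiders (R - {r}) r"
  let ?A = "\<Union>r\<in>{r \<in> R. r < m}. ?L r"
  let ?B = "if m < Max R then (#) (Max R) ` avoiders (R - {Max R}) m else {}"
  have "avoiders R m = ?A \<union> ?B"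
  proof (rule set_eqI)
    fix l show "l \<in> avoiders R m \<longleftrightarrow> l \<in> ?A \<union> ?B"
    proof (cases l)
      case Nil
      then show ?thesis
        using assms by (auto simp: avoiders_def permutations_of_set_def)
    next
      case (Cons r l')
      have "Max R \<in> R" using assms by auto
      then show ?thesis
        unfolding Cons Cons_in_avoiders_iff[OF assms(1,2)] by auto
    qed
  qed
  moreover have "?A \<inter> ?B = {}"
    by auto
  moreover have "sum w ?A = (\<Sum>r\<in>{r \<in> R. r < m}. sum w (?L r))"
    using assms by (intro sum.UNION_disjoint) auto
  moreover have "sum w ((#) r ` S) = (\<Sum>l\<in>S. w (r # l))" for r and S
    by (simp add: sum.reindex)
  moreover have "finite ?A" "finite ?B"
    using assms by auto
  ultimately show ?thesis
    by (simp add: sum.union_disjoint)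
qed

text \<open>
  The threshold \<open>t\<close> may or may not belong to \<open>R\<close>: this allows removing the largest starting
  value \<open>r < t\<close> by lowering the threshold to \<open>r\<close> while keeping \<open>R\<close>.
\<close>

definition start_sum :: "nat set \<Rightarrow> nat \<Rightarrow> rat fps" where
  "start_sum R t = (\<Sum>r\<in>{r \<in> R. r < t}. \<Sum>l\<in>avoiders (R - {r}) r. fps_X ^ des (r # l))"

lemma sum_des_avoiders:
  assumes "finite R" "m \<notin> R" "R \<noteq> {}"
  shows "(\<Sum>l\<in>avoiders R m. fps_X ^ des (m # l)) = fps_X * start_sum R m +
    (if m < Max R then \<Sum>l\<in>avoiders (R - {Max R}) m. fps_X ^ des (Max R # l) else 0)"
  unfolding sum_avoiders[OF assms] start_sum_def
  by (simp add: sum_distrib_left)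

text \<open>The last entry read is now \<open>c\<close>, so the step to \<open>Max R\<close> is a
  descent too, whereas from \<open>m\<close> it is an ascent. In \<open>rat fps\<close>,
  \<open>fps_X\<close> is the variable y.\<close>

lemma sum_des_avoiders_top:
  assumes "finite R" "m \<notin> R" "R \<noteq> {}" "\<forall>r\<in>R. r < c"
  shows "(\<Sum>l\<in>avoiders R m. fps_X ^ des (c # l)) = fps_X * start_sum R m +
    (if m < Max R then fps_X * (\<Sum>l\<in>avoiders (R - {Max R}) m. fps_X ^ des (Max R # l)) else 0)"
proof -
  have "Max R < c"
    using assms by auto
  with assms(4) show ?thesis
    unfolding sum_avoiders[OF assms(1-3)] start_sum_def
    by (simp add: sum_distrib_left)
qed

lemma start_sum_peel:
  assumes "finite R" "r \<in> R" "r < t" "\<forall>q\<in>R. q < t \<longrightarrow> q \<le> r"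
  shows "start_sum R t = (\<Sum>l\<in>avoiders (R - {r}) r. fps_X ^ des (r # l)) + start_sum R r"
proof -
  have "{q \<in> R. q < t} = insert r {q \<in> R. q < r}"
    using assms by force
  with assms(1) show ?thesis
    by (simp add: start_sum_def)
qed

text \<open>The artificial minimum \<open>Suc n\<close> exceeds every entry, so it starts no pattern
  and only the case of a new minimum remains.\<close>

lemma sum_S123:
  assumes "n > 0"
  shows "(\<Sum>\<sigma>\<in>S123 n. fps_X ^ des \<sigma>) = start_sum {1..n} (Suc n)"
proof -
  have "S123 n = avoiders {1..n} (Suc n)"
    unfolding S123_def avoiders_def
    by (auto simp: contains_123_Cons permutations_of_set_def ascent_above_max)
  moreover have "{1..n} \<noteq> {}" using assms by auto
  moreover from this have "\<not> Suc n < Max {1..n}"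
    by (subst Max_gr_iff) auto
  ultimately show ?thesis
    by (simp add: sum_avoiders start_sum_def)
qed

section \<open>Completion sums as coefficients of a solution of the linear system\<close>

text \<open>The exponent of x counts the elements below the threshold, the index those above. The
  three claims need a joint induction, since removing an element leads from one to another.\<close>

lemma sums_eq_coeffs:
  fixes s g h :: "nat \<Rightarrow> fps2"
  assumes s: "\<And>b. s b = X * (s (Suc b) + g b)"
    and g: "g 0 = 1 + Y * s 0" "\<And>b. g (Suc b) = Y * s (Suc b) + h b"
    and h: "h 0 = 1 + Y * s 0" "\<And>b. h (Suc b) = Y * s (Suc b) + Y * h b"
    and "finite R"
  shows "(\<forall>t. start_sum R t = s (card {r \<in> R. t \<le> r}) $ card {r \<in> R. r < t}) \<and>
    (\<forall>m. m \<notin> R \<longrightarrow> (\<Sum>l\<in>avoiders R m. fps_X ^ des (m # l)) =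
      g (card {r \<in> R. m < r}) $ card {r \<in> R. r < m}) \<and>
    (\<forall>m c. m \<notin> R \<longrightarrow> (\<forall>r\<in>R. r < c) \<longrightarrow> (\<Sum>l\<in>avoiders R m. fps_X ^ des (c # l)) =
      h (card {r \<in> R. m < r}) $ card {r \<in> R. r < m})"
  using \<open>finite R\<close>
proof (induction "card R" arbitrary: R rule: less_induct)
  case less
  have IH_g: "(\<Sum>l\<in>avoiders (R - {r}) m. fps_X ^ des (m # l)) =
      g (card {q \<in> R - {r}. m < q}) $ card {q \<in> R - {r}. q < m}"
    if "r \<in> R" "m \<notin> R - {r}" for r m
    using less.hyps[OF card_Diff1_less[OF less.prems that(1)]] less.prems that by simp
  have IH_h: "(\<Sum>l\<in>avoiders (R - {r}) m. fps_X ^ des (c # l)) =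
      h (card {q \<in> R - {r}. m < q}) $ card {q \<in> R - {r}. q < m}"
    if "r \<in> R" "m \<notin> R - {r}" "\<forall>q\<in>R - {r}. q < c" for r m c
    using less.hyps[OF card_Diff1_less[OF less.prems that(1)]] less.prems that by simp
  have Y_nth: "(Y * f) $ a = fps_X * f $ a" for f a
    by (simp add: Y_def)
  have s_0: "s b $ 0 = 0" for b
    by (subst s) (simp add: X_def)
  have s_Suc: "s b $ Suc a = s (Suc b) $ a + g b $ a" for a b
    by (subst s) (simp add: X_def)
  note fin = \<open>finite R\<close>
  have start: "start_sum R t = s (card {r \<in> R. t \<le> r}) $ card {r \<in> R. r < t}" for t
  \<comment> \<open>The largest start \<open>r\<close> below \<open>t\<close> gives a
    \<open>g\<close> term by the outer hypothesis. The other starts form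
    \<open>start_sum R r\<close>, with one element moved from below the threshold to above it; this
    is \<open>s_Suc\<close>.\<close>
  proof (induction "card {r \<in> R. r < t}" arbitrary: t)
    case 0
    then have "{r \<in> R. r < t} = {}"
      using fin by auto
    then show ?case
      by (simp add: start_sum_def s_0 del: Collect_empty_eq)
  next
    case (Suc a)
    define r where "r = Max {r \<in> R. r < t}"
    have ne: "{r \<in> R. r < t} \<noteq> {}"
      using Suc.hyps(2) by (metis card.empty nat.distinct(1))
    have r: "r \<in> R" "r < t" and max: "\<forall>q\<in>R. q < t \<longrightarrow> q \<le> r"
      using Max_in[OF _ ne] fin unfolding r_def by auto
    have "{q \<in> R. q < t} = insert r {q \<in> R. q < r}"
      using r max by force
    then have a: "card {q \<in> R. q < r} = a"
      using Suc.hyps(2) fin by simp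
    have "{q \<in> R. r \<le> q} = insert r {q \<in> R. t \<le> q}"
      using r max by force
    then have b: "card {q \<in> R. r \<le> q} = Suc (card {q \<in> R. t \<le> q})"
      using r fin by simp
    have "{q \<in> R - {r}. q < r} = {q \<in> R. q < r}" "{q \<in> R - {r}. r < q} = {q \<in> R. t \<le> q}"
      using r max by force+
    then have "(\<Sum>l\<in>avoiders (R - {r}) r. fps_X ^ des (r # l)) = g (card {q \<in> R. t \<le> q}) $ a"
      using IH_g[OF r(1), of r] a by simp
    then show ?case
      unfolding start_sum_peel[OF fin r max]
      using Suc.hyps(1)[of r] a b by (simp add: Suc.hyps(2)[symmetric] s_Suc)
  qed
  have start': "start_sum R m = s (card {r \<in> R. m < r}) $ card {r \<in> R. r < m}" if "m \<notin> R" for m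
  proof -
    have "{r \<in> R. m \<le> r} = {r \<in> R. m < r}"
      using that by (metis le_less)
    then show ?thesis
      using start[of m] by simp
  qed
  \<comment> \<open>Once read, \<open>Max R\<close> exceeds all that remains, so the claim on
    \<open>h\<close> applies with \<open>c = Max R\<close>.\<close>
  have top: "\<exists>b. card {r \<in> R. m < r} = Suc b \<and>
      (\<Sum>l\<in>avoiders (R - {Max R}) m. fps_X ^ des (Max R # l)) = h b $ card {r \<in> R. r < m}"
    if "m \<notin> R" "R \<noteq> {}" "m < Max R" for m
  proof -
    have M: "Max R \<in> R" "\<forall>r\<in>R. r \<le> Max R"
      using that fin by auto
    then have "{r \<in> R. m < r} = insert (Max R) {r \<in> R - {Max R}. m < r}"
      "{r \<in> R. r < m} = {r \<in> R - {Max R}. r < m}"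
      using that(3) by auto
    moreover have "\<forall>r\<in>R - {Max R}. r < Max R"
      using M by force
    ultimately show ?thesis
      using IH_h[OF M(1), of m "Max R"] that fin by simp
  qed
  have no_top: "card {r \<in> R. m < r} = 0" if "R \<noteq> {}" "\<not> m < Max R" for m
    using that fin by (auto dest: less_le_trans[OF _ Max_ge[OF fin]])
  have "(\<Sum>l\<in>avoiders R m. fps_X ^ des (m # l)) =
      g (card {r \<in> R. m < r}) $ card {r \<in> R. r < m}" if m: "m \<notin> R" for m
  proof (cases "R = {}")
    case True
    then show ?thesis by (simp add: avoiders_empty g Y_nth s_0)
  next
    case False
    show ?thesis
    proof (cases "m < Max R")
      case True
      then show ?thesis
        using top[OF m False True] sum_des_avoiders[OF fin m False] start'[OF m]
        by (auto simp: g Y_nth)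
    next
      case no: False
      \<comment> \<open>All of the nonempty \<open>R\<close> lies below \<open>m\<close>, so the
        exponent is positive and the constant 1 in \<open>g 0\<close> does not contribute.\<close>
      then have "{r \<in> R. r < m} \<noteq> {}"
        using m False fin by (metis (mono_tags, lifting) Max_in empty_iff linorder_neqE_nat mem_Collect_eq)
      then have "card {r \<in> R. r < m} \<noteq> 0"
        using fin by simp
      then show ?thesis
        using no no_top[OF False no] sum_des_avoiders[OF fin m False] start'[OF m]
        by (simp add: g Y_nth)
    qed
  qed
  moreover have "(\<Sum>l\<in>avoiders R m. fps_X ^ des (c # l)) =
      h (card {r \<in> R. m < r}) $ card {r \<in> R. r < m}"
    if m: "m \<notin> R" and c: "\<forall>r\<in>R. r < c" for m c
  proof (cases "R = {}")
    case True
    then show ?thesis by (simp add: avoiders_empty h Y_nth s_0)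
  next
    case False
    show ?thesis
    proof (cases "m < Max R")
      case True
      then show ?thesis
        using top[OF m False True] sum_des_avoiders_top[OF fin m False c] start'[OF m]
        by (auto simp: h Y_nth)
    next
      case no: False
      then have "{r \<in> R. r < m} \<noteq> {}"
        using m False fin by (metis (mono_tags, lifting) Max_in empty_iff linorder_neqE_nat mem_Collect_eq)
      then have "card {r \<in> R. r < m} \<noteq> 0"
        using fin by simp
      then show ?thesis
        using no no_top[OF False no] sum_des_avoiders_top[OF fin m False c] start'[OF m]
        by (simp add: h Y_nth)
    qed
  qed
  ultimately show ?case
    using start by simp
qed

text \<open>The 1 is the empty permutation. For \<open>n > 0\<close> the threshold
  \<open>Suc n\<close> has \<open>n\<close> values below and none above, hence index 0 and exponent
  \<open>n\<close>.\<close>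

lemma E_eq_1_plus:
  fixes s g h :: "nat \<Rightarrow> fps2"
  assumes s: "\<And>b. s b = X * (s (Suc b) + g b)"
    and g: "g 0 = 1 + Y * s 0" "\<And>b. g (Suc b) = Y * s (Suc b) + h b"
    and h: "h 0 = 1 + Y * s 0" "\<And>b. h (Suc b) = Y * s (Suc b) + Y * h b"
  shows "E = 1 + s 0"
proof (rule fps_ext)
  fix n show "E $ n = (1 + s 0) $ n"
  proof (cases "n = 0")
    case True
    moreover have "S123 0 = {[]}"
      by (auto simp: S123_def)
    moreover have "s 0 $ 0 = 0"
      by (subst s) (simp add: X_def)
    ultimately show ?thesis
      by (simp add: E_def)
  next
    case False
    moreover have "{r \<in> {1..n}. Suc n \<le> r} = {}" "{r \<in> {1..n}. r < Suc n} = {1..n}"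
      by auto
    then have "start_sum {1..n} (Suc n) = s 0 $ n"
      using sums_eq_coeffs[OF s g h, of "{1..n}"] by (metis card.empty card_atLeastAtMost
        diff_Suc_1 finite_atLeastAtMost)
    ultimately show ?thesis
      by (simp add: E_def sum_S123)
  qed
qed

text \<open>
  The coefficient ring of \<open>fps2\<close> is not a field, so \<open>k\<close> and the inverses are not available from
  \<open>fps_radical\<close> and \<open>inverse\<close>.
\<close>

fun quadratic_coeff :: "(nat \<Rightarrow> 'a :: comm_ring_1) \<Rightarrow> nat \<Rightarrow> 'a" where
  "quadratic_coeff c 0 = c 0"
| "quadratic_coeff c (Suc n) =
     c (Suc n) + (\<Sum>i\<in>{0..n}. quadratic_coeff c i * quadratic_coeff c (n - i))"

text \<open>The factor \<open>fps_X\<close> makes each coefficient of \<open>k\<close> depend on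
  earlier ones only.\<close>

lemma fps_quadratic_solution:
  fixes c :: "'a :: comm_ring_1 fps"
  obtains k where "k = c + fps_X * k ^ 2"
proof
  define k where "k = Abs_fps (quadratic_coeff (fps_nth c))"
  show "k = c + fps_X * k ^ 2"
  proof (rule fps_ext)
    fix n show "k $ n = (c + fps_X * k ^ 2) $ n"
      by (cases n)
        (simp_all add: k_def power2_eq_square fps_mult_nth[of "Abs_fps _"] del: One_nat_def)
  qed
qed

lemma fps_unit:
  fixes f :: "'a :: ring_1 fps"
  assumes "f $ 0 = 1"
  obtains f' where "f * f' = 1"
  using fps_right_inverse[of f 1] assms by auto

section \<open>The geometric solution and the resulting closed form\<close>

theorem theorem6:
  shows "Fract E 1 =
    Fract
      (- 1 + 2 * X * Y + 2 * X ^ 2 * Y - 2 * X * Y ^ 2 - 4 * X ^ 2 * Y ^ 2 + 2 * X ^ 2 * Y ^ 3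
         + sqrt2 (1 - 4 * X * Y - 4 * X ^ 2 * Y + 4 * X ^ 2 * Y ^ 2))
      (2 * X * Y ^ 2 * (X * Y - 1 - X))"
proof -
  \<comment> \<open>The radicand is \<open>1 - 4 * X * c\<close>, the discriminant of
    \<open>X * k ^ 2 - k + c\<close>.\<close>
  define c where "c = Y + X * Y - X * Y ^ 2"
  obtain k where k: "k = c + X * k ^ 2"
    using fps_quadratic_solution[of c] unfolding X_def by blast
  obtain p where p: "(1 - X * k) * p = 1"
    using fps_unit[of "1 - X * k"] by (auto simp: X_def)
  obtain v where v: "(1 - X * k - X * Y) * v = 1"
    using fps_unit[of "1 - X * k - X * Y"] by (auto simp: X_def)
  have "(k - Y) * (1 - X * k - X * Y) = X * Y"
    using k unfolding c_def by algebra
  then have kY: "k = Y + X * Y * v"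
    using v by algebra

  \<comment> \<open>With \<open>s (Suc b) = \<sigma> * k ^ b\<close>, the recursion of
    \<open>h\<close> forces \<open>Y * \<sigma> = p * (k - Y)\<close>; \<open>kY\<close> supplies
    the quotient by the non-unit \<open>Y\<close>. The value \<open>s 0\<close> is separate because
    \<open>g 0\<close> has its own equation.\<close>
  define \<sigma> where "\<sigma> = X * p * v"
  define s where "s = (\<lambda>b. case b of 0 \<Rightarrow> X * (\<sigma> + p) | Suc b \<Rightarrow> \<sigma> * k ^ b)"
  define h where "h = (\<lambda>b. p * k ^ b)"
  define g where "g = (\<lambda>b. case b of 0 \<Rightarrow> p | Suc b \<Rightarrow> Y * s (Suc b) + h b)"
  \<comment> \<open>By \<open>kY\<close>, \<open>Y * s 0 = X * k * p\<close>.\<close>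
  have p_eq: "p = 1 + Y * s 0"
    using p kY unfolding s_def \<sigma>_def nat.case by algebra
  have s_rec: "s b = X * (s (Suc b) + g b)" for b
  proof (cases b)
    case 0
    then show ?thesis by (simp add: s_def g_def)
  next
    case (Suc b')
    have "\<sigma> = X * (\<sigma> * k + Y * \<sigma> + p)"
      using v unfolding \<sigma>_def by algebra
    then have "\<sigma> * k ^ b' = X * (\<sigma> * k + Y * \<sigma> + p) * k ^ b'"
      by simp
    then show ?thesis
      by (simp add: Suc s_def g_def h_def algebra_simps)
  qed
  have h_rec: "h (Suc b) = Y * s (Suc b) + Y * h b" for b
  proof -
    have "p * k = Y * \<sigma> + Y * p"
      using kY unfolding \<sigma>_def by algebra
    then have "p * k * k ^ b = (Y * \<sigma> + Y * p) * k ^ b"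
      by simp
    then show ?thesis
      by (simp add: s_def h_def algebra_simps)
  qed
  have E: "E = 1 + s 0"
  proof (rule E_eq_1_plus)
    show "g 0 = 1 + Y * s 0" "h 0 = 1 + Y * s 0"
      using p_eq by (simp_all add: g_def h_def)
    show "g (Suc b) = Y * s (Suc b) + h b" for b
      by (simp add: g_def)
  qed (fact s_rec h_rec)+

  have sqrt: "sqrt2 (1 - 4 * X * Y - 4 * X ^ 2 * Y + 4 * X ^ 2 * Y ^ 2) = 1 - 2 * X * k"
  proof (rule sqrt2_eqI)
    show "(1 - 2 * X * k) ^ 2 = 1 - 4 * X * Y - 4 * X ^ 2 * Y + 4 * X ^ 2 * Y ^ 2"
      using k unfolding c_def by algebra
    show "(1 - 2 * X * k) $ 0 $ 0 = 1"
      by (simp add: X_def)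
  qed
  have cp: "c * p = k"
    using k p by algebra
  \<comment> \<open>One factor \<open>Y\<close> turns \<open>X * Y - 1 - X\<close> into
    \<open>- c\<close>; the other turns \<open>E\<close> into \<open>Y + Y * s 0\<close>, where
    \<open>Y * s 0 = p - 1\<close>.\<close>
  have "E * (2 * X * Y ^ 2 * (X * Y - 1 - X)) = - (2 * X * c * (Y + Y * s 0))"
    unfolding E c_def by algebra
  also have "\<dots> = 2 * X * (c - Y * c - c * p)"
    unfolding p_eq by algebra
  also have "\<dots> = - 1 + 2 * X * Y + 2 * X ^ 2 * Y - 2 * X * Y ^ 2 - 4 * X ^ 2 * Y ^ 2
      + 2 * X ^ 2 * Y ^ 3 + (1 - 2 * X * k)"
    unfolding cp unfolding c_def by algebra
  finally have "E * (2 * X * Y ^ 2 * (X * Y - 1 - X)) =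
      - 1 + 2 * X * Y + 2 * X ^ 2 * Y - 2 * X * Y ^ 2 - 4 * X ^ 2 * Y ^ 2 + 2 * X ^ 2 * Y ^ 3
        + (1 - 2 * X * k)" .
  moreover have "2 * X * Y ^ 2 * (X * Y - 1 - X) \<noteq> 0"
  proof -
    have "(X * Y - 1 - X) $ 0 = - 1"
      by (simp add: X_def)
    then have "X * Y - 1 - X \<noteq> 0"
      by (metis fps_zero_nth neg_equal_0_iff_equal zero_neq_one)
    then show ?thesis
      by (simp add: X_def Y_def)
  qed
  ultimately show ?thesis
    unfolding sqrt by (simp add: eq_fract)
qed

end
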